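(* Let $w=(w(1),\dots,w(N))$ be a positive weight. The weighted averaging operator $H^*$ can be applied to a rank 1 matrix $A\in\mathbb C^{N\times N}$ (given in factored form $A=xy^T$ with $x,y\in\mathbb C^N$) in $\mathcal O(N\log N)$ time (arithmetic operations); that is, all values $H^*A(m)$, $2\le m\le 2N$, can be computed in $\mathcal O(N\log N)$ time.
   Context: For an $N\times N$ matrix $A$ with indices $1,\dots,N$, the weighted averaging operator is $$H^*A(m)=\frac{1}{\omega(m)}\sum_{\substack{j+l=m\\ 1\le j,l\le N}} w(j)A(j,l)w(l),\quad 2\le m\le 2N,\qquad \omega(m)=\sum_{\substack{j+l=m\\ 1\le j,l\le N}}w(j)w(l).$$ *)

theory Defs
  imports Complex_Main "HOL-Library.Landau_Symbols"
begin

text \<open>Vectors and matrices carry the indices \<open>1, \<dots>, N\<close>: they are functions on the natural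
  numbers of which only the values at these indices are used.\<close>

definition antidiag :: "nat \<Rightarrow> nat \<Rightarrow> (nat \<times> nat) set" where
  "antidiag N m = {(j, l). j \<in> {1..N} \<and> l \<in> {1..N} \<and> j + l = m}"

definition omega :: "nat \<Rightarrow> (nat \<Rightarrow> real) \<Rightarrow> nat \<Rightarrow> real" where
  "omega N w m = (\<Sum>(j, l)\<in>antidiag N m. w j * w l)"

definition Hstar :: "nat \<Rightarrow> (nat \<Rightarrow> real) \<Rightarrow> (nat \<Rightarrow> nat \<Rightarrow> complex) \<Rightarrow> nat \<Rightarrow> complex" where
  "Hstar N w A m =
     1 / of_real (omega N w m) *
     (\<Sum>(j, l)\<in>antidiag N m. of_real (w j) * A j l * of_real (w l))"

text \<open>Arithmetic operations are counted in the standard model of algebraic complexity: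
  straight-line programs over the complex numbers. The memory is a list that initially holds the
  input; every instruction appends one value, computed from earlier entries. There are no tests
  and no other elementary functions. A reference to a missing entry and a division by zero make
  the execution fail (\<^const>\<open>None\<close>); so the convention \<open>a / 0 = 0\<close> cannot be used by a program.\<close>

datatype instr =
    Const complex
  | Add nat nat
  | Sub nat nat
  | Mul nat nat
  | Div nat nat

fun instr_value :: "complex list \<Rightarrow> instr \<Rightarrow> complex option" where
  "instr_value vs (Const c) = Some c"
| "instr_value vs (Add i j) =
     (if i < length vs \<and> j < length vs then Some (vs ! i + vs ! j) else None)"
| "instr_value vs (Sub i j) =
     (if i < length vs \<and> j < length vs then Some (vs ! i - vs ! j) else None)"
| "instr_value vs (Mul i j) =
     (if i < length vs \<and> j < length vs then Some (vs ! i * vs ! j) else None)"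
| "instr_value vs (Div i j) =
     (if i < length vs \<and> j < length vs \<and> vs ! j \<noteq> 0 then Some (vs ! i / vs ! j) else None)"

fun run :: "instr list \<Rightarrow> complex list \<Rightarrow> complex list option" where
  "run [] vs = Some vs"
| "run (c # cs) vs =
     (case instr_value vs c of None \<Rightarrow> None | Some v \<Rightarrow> run cs (vs @ [v]))"

text \<open>A program consists of its instructions and of the list of addresses at which the results
  are found. Loading a constant is charged like an arithmetic operation.\<close>

type_synonym program = "instr list \<times> nat list"

definition num_ops :: "program \<Rightarrow> nat" where
  "num_ops P = length (fst P)"

definition computes :: "program \<Rightarrow> complex list \<Rightarrow> complex list \<Rightarrow> bool" where
  "computes P inp out \<longleftrightarrow>
     (\<exists>vs. run (fst P) inp = Some vs \<and> (\<forall>i\<in>set (snd P). i < length vs) \<and>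
           map (\<lambda>i. vs ! i) (snd P) = out)"

end

theory Submission
  imports Defs "HOL-Real_Asymp.Real_Asymp"
begin

text \<open>For \<open>A j l = x j * y l\<close> both sums over the antidiagonal \<open>j + l = m\<close> are convolutions:
  the numerator of \<open>Hstar\<close> is that of the vectors \<open>w j * x j\<close> and \<open>w l * y l\<close>, and \<open>omega\<close> is
  that of \<open>w\<close> with itself. Padded with zeros to a length \<open>2 ^ p\<close> above \<open>2 * N\<close>, they can be
  computed by the discrete Fourier transform, since no index sum wraps around modulo \<open>2 ^ p\<close>: two
  transforms, a pointwise product and an inverse transform (\<open>convolution_by_dft\<close>). The radix-2
  recursion \<open>dft_radix2\<close> makes each transform cost \<open>O(p * 2 ^ p)\<close> operations
  (\<open>fast_fourier_transform\<close>), and \<open>p\<close> can be chosen with \<open>2 ^ p \<le> 4 * N\<close>, which gives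
  \<open>O(N * ln N)\<close>. The final divisions are legal because \<open>omega\<close> is positive for a positive weight.

  Programs are never written down address by address. A program that runs on a whole
  family \<open>D\<close> of inputs is described by the set of functions of the input that its memory
  contains, and \<open>computable_in\<close> bounds the cost of enlarging this set. Its closure rules
  turn operation counts into calculations with expressions.\<close>

section \<open>A cost calculus for straight-line programs\<close>

text \<open>The list \<open>fs\<close> is a symbolic memory: its entries are the functions that map an input
  \<open>t \<in> D\<close> to the stored values. It may contain more than \<open>S\<close>, in any order, which
  is what makes the notion monotone in \<open>S\<close> and closed under composition. One program has to serve
  all inputs in \<open>D\<close>; what holds on \<open>D\<close> (such as a nonzero denominator) can be used to show that
  it does not fail.\<close>

definition computable_in ::
  "'i set \<Rightarrow> nat \<Rightarrow> ('i \<Rightarrow> complex) set \<Rightarrow> ('i \<Rightarrow> complex) set \<Rightarrow> bool" where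
  "computable_in D c S T \<longleftrightarrow>
     (\<forall>fs. S \<subseteq> set fs \<longrightarrow>
        (\<exists>gs cs. length cs \<le> c \<and> T \<subseteq> set (fs @ gs) \<and>
           (\<forall>t\<in>D. run cs (map (\<lambda>f. f t) fs) = Some (map (\<lambda>f. f t) (fs @ gs)))))"

lemma run_append:
  "run (cs @ ds) vs = (case run cs vs of None \<Rightarrow> None | Some us \<Rightarrow> run ds us)"
  by (induction cs arbitrary: vs) (auto split: option.split)

lemma computable_in_subset: "T \<subseteq> S \<Longrightarrow> computable_in D 0 S T"
  unfolding computable_in_def by (intro allI impI exI[of _ "[]"]) auto

lemma computable_in_mono:
  assumes "computable_in D c S T" "c \<le> c'" "S \<subseteq> S'" "T' \<subseteq> T"
  shows "computable_in D c' S' T'"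
  unfolding computable_in_def
proof (intro allI impI)
  fix fs assume "S' \<subseteq> set fs"
  then have "S \<subseteq> set fs"
    using assms(3) by blast
  then obtain gs cs where "length cs \<le> c" "T \<subseteq> set (fs @ gs)"
    "\<forall>t\<in>D. run cs (map (\<lambda>f. f t) fs) = Some (map (\<lambda>f. f t) (fs @ gs))"
    using assms(1) unfolding computable_in_def by blast
  then show "\<exists>gs cs. length cs \<le> c' \<and> T' \<subseteq> set (fs @ gs) \<and>
      (\<forall>t\<in>D. run cs (map (\<lambda>f. f t) fs) = Some (map (\<lambda>f. f t) (fs @ gs)))"
    using assms(2,4) by (intro exI[of _ gs] exI[of _ cs]) auto
qed

lemma computable_in_trans:
  assumes "computable_in D c S T" "computable_in D d (S \<union> T) U"
  shows "computable_in D (c + d) S (T \<union> U)"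
  unfolding computable_in_def
proof (intro allI impI)
  fix fs assume S: "S \<subseteq> set fs"
  then obtain gs cs where 1: "length cs \<le> c" "T \<subseteq> set (fs @ gs)"
    "\<forall>t\<in>D. run cs (map (\<lambda>f. f t) fs) = Some (map (\<lambda>f. f t) (fs @ gs))"
    using assms(1) unfolding computable_in_def by blast
  have "S \<union> T \<subseteq> set (fs @ gs)"
    using S 1(2) by auto
  then obtain hs ds where 2: "length ds \<le> d" "U \<subseteq> set ((fs @ gs) @ hs)"
    "\<forall>t\<in>D. run ds (map (\<lambda>f. f t) (fs @ gs)) = Some (map (\<lambda>f. f t) ((fs @ gs) @ hs))"
    using assms(2) unfolding computable_in_def by blast
  show "\<exists>gs cs. length cs \<le> c + d \<and> T \<union> U \<subseteq> set (fs @ gs) \<and>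
      (\<forall>t\<in>D. run cs (map (\<lambda>f. f t) fs) = Some (map (\<lambda>f. f t) (fs @ gs)))"
    using 1 2 by (intro exI[of _ "gs @ hs"] exI[of _ "cs @ ds"]) (auto simp: run_append)
qed

lemma computable_in_Un:
  assumes "computable_in D c S T" "computable_in D d S U"
  shows "computable_in D (c + d) S (T \<union> U)"
  by (rule computable_in_trans[OF assms(1)]) (rule computable_in_mono[OF assms(2)], auto)

lemma computable_in_image:
  assumes "finite I" "\<And>i. i \<in> I \<Longrightarrow> computable_in D c S {f i}"
  shows "computable_in D (card I * c) S (f ` I)"
  using assms
proof (induction I rule: finite_induct)
  case empty
  then show ?case by (simp add: computable_in_subset)
next
  case (insert i I)
  then have "computable_in D (c + card I * c) S ({f i} \<union> f ` I)"
    by (intro computable_in_Un) auto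
  then show ?case using insert.hyps by simp
qed

lemma computable_in_instr:
  assumes "\<And>fs. S \<subseteq> set fs \<Longrightarrow>
    \<exists>ins. \<forall>t\<in>D. instr_value (map (\<lambda>h. h t) fs) ins = Some (f t)"
  shows "computable_in D 1 S {f}"
  unfolding computable_in_def
proof (intro allI impI)
  fix fs assume "S \<subseteq> set fs"
  then obtain ins where "\<forall>t\<in>D. instr_value (map (\<lambda>h. h t) fs) ins = Some (f t)"
    using assms by blast
  then show "\<exists>gs cs. length cs \<le> 1 \<and> {f} \<subseteq> set (fs @ gs) \<and>
      (\<forall>t\<in>D. run cs (map (\<lambda>f. f t) fs) = Some (map (\<lambda>f. f t) (fs @ gs)))"
    by (intro exI[of _ "[f]"] exI[of _ "[ins]"]) auto
qed

lemma computable_in_const: "computable_in D 1 S {\<lambda>_. z}"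
proof (rule computable_in_instr)
  fix fs :: "('a \<Rightarrow> complex) list"
  show "\<exists>ins. \<forall>t\<in>D. instr_value (map (\<lambda>h. h t) fs) ins = Some z"
    by (intro exI[of _ "Const z"]) simp
qed

text \<open>The positions \<open>i\<close> and \<open>j\<close> in \<open>op\<close> are arbitrary because it is not known where the programs
  for \<open>f\<close> and \<open>g\<close> leave their results; the instruction for \<open>h\<close> is chosen once they are.\<close>

lemma computable_in_binary:
  assumes f: "computable_in D c S {f}" and g: "computable_in D d S {g}"
    and op: "\<And>fs i j. \<lbrakk>i < length fs; j < length fs; fs ! i = f; fs ! j = g\<rbrakk> \<Longrightarrow>
      \<exists>ins. \<forall>t\<in>D. instr_value (map (\<lambda>h. h t) fs) ins = Some (h t)"
  shows "computable_in D (c + d + 1) S {h}"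
proof -
  have "computable_in D 1 (S \<union> ({f} \<union> {g})) {h}"
  proof (rule computable_in_instr)
    fix fs assume "S \<union> ({f} \<union> {g}) \<subseteq> set fs"
    then have "f \<in> set fs" "g \<in> set fs"
      by auto
    then obtain i j where "i < length fs" "j < length fs" "fs ! i = f" "fs ! j = g"
      unfolding in_set_conv_nth by blast
    then show "\<exists>ins. \<forall>t\<in>D. instr_value (map (\<lambda>h. h t) fs) ins = Some (h t)"
      by (rule op)
  qed
  from computable_in_trans[OF computable_in_Un[OF f g] this] show ?thesis
    by (rule computable_in_mono) auto
qed

lemma computable_in_add:
  assumes "computable_in D c S {f}" "computable_in D d S {g}"
  shows "computable_in D (c + d + 1) S {\<lambda>t. f t + g t}"
proof (rule computable_in_binary[OF assms])
  fix fs i j assume "i < length fs" "j < length fs" "fs ! i = f" "fs ! j = g"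
  then show "\<exists>ins. \<forall>t\<in>D. instr_value (map (\<lambda>h. h t) fs) ins = Some (f t + g t)"
    by (intro exI[of _ "Add i j"]) auto
qed

lemma computable_in_mult:
  assumes "computable_in D c S {f}" "computable_in D d S {g}"
  shows "computable_in D (c + d + 1) S {\<lambda>t. f t * g t}"
proof (rule computable_in_binary[OF assms])
  fix fs i j assume "i < length fs" "j < length fs" "fs ! i = f" "fs ! j = g"
  then show "\<exists>ins. \<forall>t\<in>D. instr_value (map (\<lambda>h. h t) fs) ins = Some (f t * g t)"
    by (intro exI[of _ "Mul i j"]) auto
qed

lemma computable_in_divide:
  assumes "computable_in D c S {f}" "computable_in D d S {g}" "\<And>t. t \<in> D \<Longrightarrow> g t \<noteq> 0"
  shows "computable_in D (c + d + 1) S {\<lambda>t. f t / g t}"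
proof (rule computable_in_binary[OF assms(1,2)])
  fix fs i j assume "i < length fs" "j < length fs" "fs ! i = f" "fs ! j = g"
  then show "\<exists>ins. \<forall>t\<in>D. instr_value (map (\<lambda>h. h t) fs) ins = Some (f t / g t)"
    using assms(3) by (intro exI[of _ "Div i j"]) auto
qed

lemma computable_in_mem: "f \<in> S \<Longrightarrow> computable_in D 0 S {f}"
  by (rule computable_in_subset) simp

text \<open>The addresses of the results do not depend on the input, because they are
  positions in the symbolic memory.\<close>

lemma computable_in_imp_program:
  assumes "computable_in D c (set fs) (set hs)"
  shows "\<exists>P. num_ops P \<le> c \<and>
    (\<forall>t\<in>D. computes P (map (\<lambda>f. f t) fs) (map (\<lambda>h. h t) hs))"
proof -
  obtain gs cs where len: "length cs \<le> c" and hs: "set hs \<subseteq> set (fs @ gs)"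
    and run: "\<forall>t\<in>D. run cs (map (\<lambda>f. f t) fs) = Some (map (\<lambda>f. f t) (fs @ gs))"
    using assms unfolding computable_in_def by blast
  have "\<forall>h\<in>set hs. \<exists>i<length (fs @ gs). (fs @ gs) ! i = h"
    using hs by (meson in_set_conv_nth subsetD)
  then obtain addr where
    addr: "\<And>h. h \<in> set hs \<Longrightarrow> addr h < length (fs @ gs) \<and> (fs @ gs) ! addr h = h"
    by metis
  have "computes (cs, map addr hs) (map (\<lambda>f. f t) fs) (map (\<lambda>h. h t) hs)" if "t \<in> D" for t
    unfolding computes_def
  proof (intro exI conjI)
    show "run (fst (cs, map addr hs)) (map (\<lambda>f. f t) fs) = Some (map (\<lambda>f. f t) (fs @ gs))"
      using run that by simp
    show "\<forall>i\<in>set (snd (cs, map addr hs)). i < length (map (\<lambda>f. f t) (fs @ gs))"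
      using addr by auto
    have "map (\<lambda>f. f t) (fs @ gs) ! addr h = h t" if "h \<in> set hs" for h
      using addr[OF that] by (metis nth_map)
    then show "map (\<lambda>i. map (\<lambda>f. f t) (fs @ gs) ! i) (snd (cs, map addr hs)) = map (\<lambda>h. h t) hs"
      by simp
  qed
  then show ?thesis
    using len by (intro exI[of _ "(cs, map addr hs)"]) (simp add: num_ops_def)
qed

section \<open>The fast Fourier transform\<close>

definition dft :: "nat \<Rightarrow> complex \<Rightarrow> (nat \<Rightarrow> complex) \<Rightarrow> nat \<Rightarrow> complex" where
  "dft n u a i = (\<Sum>j<n. a j * u ^ (i * j))"

lemma power_mod_root_of_unity:
  fixes u :: "'a::monoid_mult"
  assumes "u ^ n = 1"
  shows "u ^ (i mod n) = u ^ i"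
proof -
  have "u ^ i = u ^ (n * (i div n) + i mod n)"
    by simp
  also have "\<dots> = u ^ (i mod n)"
    unfolding power_add power_mult using assms by simp
  finally show ?thesis ..
qed

lemma dft_mod:
  assumes "u ^ n = 1"
  shows "dft n u a (i mod n) = dft n u a i"
  unfolding dft_def by (simp add: power_mult power_mod_root_of_unity[OF assms])

lemma sum_even_odd:
  fixes f :: "nat \<Rightarrow> 'a::comm_monoid_add"
  shows "(\<Sum>j<2 * n. f j) = (\<Sum>j<n. f (2 * j)) + (\<Sum>j<n. f (2 * j + 1))"
  by (induction n) (simp_all add: ac_simps)

text \<open>Splitting the sum by the parity of the index leaves two transforms of half the length for
  the root of unity \<open>u\<^sup>2\<close>. These are periodic with period \<open>n\<close>, so only \<open>n\<close> values of each occur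
  among the \<open>2 * n\<close> outputs, and every output needs one constant, one product and one sum.\<close>

lemma dft_radix2:
  assumes "u ^ (2 * n) = 1"
  shows "dft (2 * n) u a i =
    dft n (u\<^sup>2) (\<lambda>j. a (2 * j)) (i mod n) + u ^ i * dft n (u\<^sup>2) (\<lambda>j. a (2 * j + 1)) (i mod n)"
proof -
  have "(u\<^sup>2) ^ n = 1"
    using assms by (simp add: power_mult)
  note period = dft_mod[OF this]
  have pow: "u ^ (i * (2 * j)) = (u\<^sup>2) ^ (i * j)"
    and pow_Suc: "u ^ (i * (2 * j + 1)) = u ^ i * (u\<^sup>2) ^ (i * j)" for j
    by (simp_all add: power_mult[symmetric] power_add[symmetric] algebra_simps)
  have "dft (2 * n) u a i = (\<Sum>j<n. a (2 * j) * (u\<^sup>2) ^ (i * j)) +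
      (\<Sum>j<n. a (2 * j + 1) * (u ^ i * (u\<^sup>2) ^ (i * j)))"
    unfolding dft_def sum_even_odd pow pow_Suc ..
  then show ?thesis
    unfolding period by (simp add: dft_def sum_distrib_left mult.left_commute)
qed

lemma fast_fourier_transform:
  assumes "u ^ (2 ^ p) = 1"
  shows "computable_in D (3 * p * 2 ^ p)
    ((\<lambda>j t. a t j) ` {..<2 ^ p}) ((\<lambda>i t. dft (2 ^ p) u (a t) i) ` {..<2 ^ p})"
  using assms
proof (induction p arbitrary: u a)
  case 0
  have "{..<2 ^ 0} = {0 :: nat}"
    by auto
  then show ?case
    by (auto simp: dft_def intro!: computable_in_subset)
next
  case (Suc p)
  let ?n = "2 ^ p :: nat"
  let ?S = "(\<lambda>j t. a t j) ` {..<2 ^ Suc p}"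
  define E where "E i t = dft ?n (u\<^sup>2) (\<lambda>j. a t (2 * j)) i" for i t
  define F where "F i t = dft ?n (u\<^sup>2) (\<lambda>j. a t (2 * j + 1)) i" for i t
  have u2: "(u\<^sup>2) ^ 2 ^ p = 1"
    using Suc.prems by (simp add: power_mult)
  have "computable_in D (3 * p * ?n) ?S (E ` {..<?n})"
    unfolding E_def by (rule computable_in_mono[OF Suc.IH[OF u2, of "\<lambda>t j. a t (2 * j)"]]) auto
  moreover have "computable_in D (3 * p * ?n) ?S (F ` {..<?n})"
    unfolding F_def by (rule computable_in_mono[OF Suc.IH[OF u2, of "\<lambda>t j. a t (2 * j + 1)"]]) auto
  ultimately have halves:
    "computable_in D (3 * p * ?n + 3 * p * ?n) ?S (E ` {..<?n} \<union> F ` {..<?n})"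
    by (rule computable_in_Un)
  let ?S' = "?S \<union> (E ` {..<?n} \<union> F ` {..<?n})"
  have "computable_in D 3 ?S' {\<lambda>t. dft (2 ^ Suc p) u (a t) i}" for i
  proof -
    have EF: "E (i mod ?n) \<in> ?S'" "F (i mod ?n) \<in> ?S'"
      by auto
    have "computable_in D (0 + (1 + 0 + 1) + 1) ?S' {\<lambda>t. E (i mod ?n) t + u ^ i * F (i mod ?n) t}"
      by (intro computable_in_add computable_in_mult computable_in_const computable_in_mem EF)
    moreover have "dft (2 ^ Suc p) u (a t) i = E (i mod ?n) t + u ^ i * F (i mod ?n) t" for t
      using dft_radix2[of u ?n "a t" i] Suc.prems by (simp add: E_def F_def)
    ultimately show ?thesis
      by (simp add: numeral_3_eq_3)
  qed
  then have "computable_in D (card {..<2 ^ Suc p :: nat} * 3) ?S'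
      ((\<lambda>i t. dft (2 ^ Suc p) u (a t) i) ` {..<2 ^ Suc p})"
    by (intro computable_in_image) auto
  from computable_in_trans[OF halves this] show ?case
    by (rule computable_in_mono) (auto simp: algebra_simps)
qed

section \<open>Fast convolution\<close>

lemma sum_powers_root_of_unity:
  fixes z :: complex
  assumes "z ^ n = 1"
  shows "(\<Sum>i<n. z ^ i) = (if z = 1 then of_nat n else 0)"
  using assms by (simp add: geometric_sum)

text \<open>Substituting the definition of the transforms produces the sums of the powers of
  \<open>u ^ (j + l) * inverse u ^ m\<close>; by orthogonality only the terms with \<open>u ^ (j + l) = u ^ m\<close>
  survive. Since the supports keep \<open>j + l\<close> below \<open>M\<close>, this forces \<open>j + l = m\<close> itself
  and not merely a congruence modulo \<open>M\<close>.\<close>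

lemma convolution_by_dft:
  assumes u: "u ^ M = 1" "inj_on (\<lambda>k. u ^ k) {..<M}"
    and supp: "\<And>j. j \<notin> {1..N} \<Longrightarrow> a j = 0" "\<And>l. l \<notin> {1..N} \<Longrightarrow> b l = 0"
    and bounds: "2 * N < M" "m < M"
  shows "(\<Sum>(j, l)\<in>antidiag N m. a j * b l) =
    dft M (inverse u) (\<lambda>i. dft M u a i * dft M u b i) m * (1 / of_nat M)"
proof -
  have "u \<noteq> 0"
    using u(1) bounds by (metis not_less_zero power_0_left zero_neq_one)
  have orth: "a j * b l * (\<Sum>i<M. (u ^ (j + l) * inverse u ^ m) ^ i) =
      (if j + l = m then a j * b l * of_nat M else 0)" for j l
  proof (cases "j \<in> {1..N} \<and> l \<in> {1..N}")
    case True
    then have "j + l < M"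
      using bounds by auto
    then have "u ^ (j + l) = u ^ m \<longleftrightarrow> j + l = m"
      using u(2) bounds(2) by (auto dest: inj_onD)
    then have "u ^ (j + l) * inverse u ^ m = 1 \<longleftrightarrow> j + l = m"
      using \<open>u \<noteq> 0\<close> by (simp add: power_inverse field_simps)
    moreover have "(u ^ (j + l) * inverse u ^ m) ^ M = (u ^ M) ^ (j + l) * inverse (u ^ M) ^ m"
      by (simp add: power_mult_distrib power_inverse power_mult[symmetric] mult.commute)
    then have "(u ^ (j + l) * inverse u ^ m) ^ M = 1"
      using u(1) by simp
    ultimately show ?thesis
      by (simp add: sum_powers_root_of_unity)
  next
    case False
    then have "a j * b l = 0"
      using supp by auto
    then show ?thesis by simp
  qed
  have "dft M (inverse u) (\<lambda>i. dft M u a i * dft M u b i) m =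
      (\<Sum>i<M. \<Sum>j<M. \<Sum>l<M. a j * b l * (u ^ (j + l) * inverse u ^ m) ^ i)"
    unfolding dft_def[of M "inverse u"]
  proof (rule sum.cong[OF refl])
    fix i
    have "u ^ (i * j) * u ^ (i * l) * inverse u ^ (m * i) = (u ^ (j + l) * inverse u ^ m) ^ i"
      for j l
      by (simp add: power_mult_distrib power_mult[symmetric] power_add[symmetric] algebra_simps)
    then have "a j * u ^ (i * j) * (b l * u ^ (i * l)) * inverse u ^ (m * i) =
        a j * b l * (u ^ (j + l) * inverse u ^ m) ^ i" for j l
      by (metis mult.assoc mult.left_commute)
    then show "dft M u a i * dft M u b i * inverse u ^ (m * i) =
        (\<Sum>j<M. \<Sum>l<M. a j * b l * (u ^ (j + l) * inverse u ^ m) ^ i)"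
      unfolding dft_def sum_product unfolding sum_distrib_right by (simp only:)
  qed
  also have "\<dots> = (\<Sum>j<M. \<Sum>l<M. a j * b l * (\<Sum>i<M. (u ^ (j + l) * inverse u ^ m) ^ i))"
    unfolding sum_distrib_left by (subst sum.swap) (intro sum.cong refl sum.swap)
  also have "\<dots> = (\<Sum>(j, l)\<in>{..<M} \<times> {..<M}. if j + l = m then a j * b l * of_nat M else 0)"
    unfolding orth by (rule sum.cartesian_product)
  also have "\<dots> = (\<Sum>(j, l)\<in>antidiag N m. a j * b l * of_nat M)"
  proof (rule sum.mono_neutral_cong_right)
    have "a j * b l = 0" if "(j, l) \<notin> antidiag N m" "j + l = m" for j l
      using that supp(1)[of j] supp(2)[of l] unfolding antidiag_def by auto
    then show "\<forall>q\<in>{..<M} \<times> {..<M} - antidiag N m.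
        (case q of (j, l) \<Rightarrow> if j + l = m then a j * b l * of_nat M else 0) = 0"
      by auto
  qed (use bounds in \<open>auto simp: antidiag_def\<close>)
  also have "\<dots> = (\<Sum>(j, l)\<in>antidiag N m. a j * b l) * of_nat M"
    by (simp add: sum_distrib_right case_prod_unfold)
  finally show ?thesis
    using bounds by simp
qed

lemma ex_primitive_root_of_unity:
  assumes "0 < M"
  obtains u :: complex where "u ^ M = 1" "inj_on (\<lambda>k. u ^ k) {..<M}"
proof
  let ?u = "cis (2 * pi / real M)"
  have pow: "?u ^ k = cis (2 * pi * real k / real M)" for k
    by (simp add: DeMoivre mult_ac)
  show "?u ^ M = 1"
    using assms by (simp add: pow)
  show "inj_on (\<lambda>k. ?u ^ k) {..<M}"
    unfolding pow using bij_betw_roots_unity[OF assms] by (rule bij_betw_imp_inj_on)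
qed

text \<open>Three transforms account for \<open>9 * p * 2 ^ p\<close>. The padding costs one constant \<open>0\<close>, shared
  by all indices outside \<open>{1..N}\<close>; the rest is the pointwise product and the scaling by
  \<open>1 / 2 ^ p\<close>.\<close>

lemma fast_convolution:
  assumes "2 * N < 2 ^ p"
  shows "computable_in D (9 * p * 2 ^ p + 3 * 2 ^ p + 1)
    ((\<lambda>j t. a t j) ` {1..N} \<union> (\<lambda>l t. b t l) ` {1..N})
    ((\<lambda>m t. \<Sum>(j, l)\<in>antidiag N m. a t j * b t l) ` {2..2 * N})"
proof -
  let ?M = "2 ^ p :: nat"
  let ?S0 = "(\<lambda>j t. a t j) ` {1..N} \<union> (\<lambda>l t. b t l) ` {1..N}"
  let ?S = "?S0 \<union> {\<lambda>_. 0}"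
  obtain u :: complex where u: "u ^ ?M = 1" "inj_on (\<lambda>k. u ^ k) {..<?M}"
    using ex_primitive_root_of_unity[of ?M] by auto
  have iu: "inverse u ^ ?M = 1"
    using u(1) by (simp add: power_inverse)
  define a' where "a' t j = (if j \<in> {1..N} then a t j else 0)" for t j
  define b' where "b' t l = (if l \<in> {1..N} then b t l else 0)" for t l
  have a'_mem: "(\<lambda>t. a' t j) \<in> ?S" and b'_mem: "(\<lambda>t. b' t j) \<in> ?S" for j
    by (cases "j \<in> {1..N}"; auto simp: a'_def b'_def)+
  define c where "c t i = dft ?M u (a' t) i * dft ?M u (b' t) i" for t i
  let ?A = "(\<lambda>i t. dft ?M u (a' t) i) ` {..<?M}"
  let ?B = "(\<lambda>i t. dft ?M u (b' t) i) ` {..<?M}"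
  let ?C = "(\<lambda>i t. c t i) ` {..<?M}"
  let ?E = "(\<lambda>m t. dft ?M (inverse u) (c t) m) ` {..<?M}"
  have "computable_in D (3 * p * ?M) ?S ?A"
    by (rule computable_in_mono[OF fast_fourier_transform[OF u(1), of D a']])
      (use a'_mem in auto)
  moreover have "computable_in D (3 * p * ?M) ?S ?B"
    by (rule computable_in_mono[OF fast_fourier_transform[OF u(1), of D b']])
      (use b'_mem in auto)
  ultimately have AB: "computable_in D (3 * p * ?M + 3 * p * ?M) ?S (?A \<union> ?B)"
    by (rule computable_in_Un)
  have "computable_in D (card {..<?M} * (0 + 0 + 1)) (?S \<union> (?A \<union> ?B)) ?C"
    unfolding c_def
    by (intro computable_in_image computable_in_mult computable_in_mem) auto
  from computable_in_trans[OF AB this]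
  have C: "computable_in D (6 * p * ?M + ?M) ?S ?C"
    by (rule computable_in_mono) auto
  have "computable_in D (3 * p * ?M) (?S \<union> ?C) ?E"
    by (rule computable_in_mono[OF fast_fourier_transform[OF iu, of D c]]) auto
  from computable_in_trans[OF C this]
  have E: "computable_in D (9 * p * ?M + ?M) ?S ?E"
    by (rule computable_in_mono) (auto simp: algebra_simps)
  have out: "computable_in D (0 + 1 + 1) (?S \<union> ?E) {\<lambda>t. \<Sum>(j, l)\<in>antidiag N m. a t j * b t l}"
    if "m \<in> {2..2 * N}" for m
  proof -
    have m: "m < ?M"
      using that assms by auto
    have "(\<Sum>(j, l)\<in>antidiag N m. a t j * b t l) =
        dft ?M (inverse u) (c t) m * (1 / of_nat ?M)" for t
    proof -
      have "(\<Sum>(j, l)\<in>antidiag N m. a t j * b t l) = (\<Sum>(j, l)\<in>antidiag N m. a' t j * b' t l)"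
        by (intro sum.cong refl) (auto simp: antidiag_def a'_def b'_def)
      also have "\<dots> = dft ?M (inverse u) (c t) m * (1 / of_nat ?M)"
        unfolding c_def[abs_def]
        by (rule convolution_by_dft[OF u _ _ assms m]) (simp_all only: a'_def b'_def if_False)
      finally show ?thesis .
    qed
    moreover have "(\<lambda>t. dft ?M (inverse u) (c t) m) \<in> ?S \<union> ?E"
      using m by auto
    then have "computable_in D (0 + 1 + 1) (?S \<union> ?E)
        {\<lambda>t. dft ?M (inverse u) (c t) m * (1 / of_nat ?M)}"
      by (intro computable_in_mult computable_in_const computable_in_mem)
    ultimately show ?thesis
      by simp
  qed
  have "computable_in D (card {2..2 * N} * (0 + 1 + 1)) (?S \<union> ?E)
      ((\<lambda>m t. \<Sum>(j, l)\<in>antidiag N m. a t j * b t l) ` {2..2 * N})"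
    by (rule computable_in_image[OF _ out]) simp_all
  from computable_in_trans[OF computable_in_const computable_in_trans[OF E this]]
  show ?thesis
    using assms by (elim computable_in_mono) auto
qed

section \<open>The averaging operator on matrices of rank one\<close>

lemma omega_pos:
  assumes "\<forall>j\<in>{1..N}. w j > 0" "m \<in> {2..2 * N}"
  shows "omega N w m > 0"
  unfolding omega_def
proof (rule sum_pos)
  show "finite (antidiag N m)"
    by (rule finite_subset[of _ "{1..N} \<times> {1..N}"]) (auto simp: antidiag_def)
  have "(m div 2, m - m div 2) \<in> antidiag N m"
    using assms(2) by (auto simp: antidiag_def)
  then show "antidiag N m \<noteq> {}"
    by blast
qed (use assms(1) in \<open>auto simp: antidiag_def\<close>)

lemma Hstar_rank1:
  assumes "\<forall>j\<in>{1..N}. \<forall>l\<in>{1..N}. A j l = x j * y l"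
  shows "Hstar N w A m =
    (\<Sum>(j, l)\<in>antidiag N m. (of_real (w j) * x j) * (of_real (w l) * y l)) /
    (\<Sum>(j, l)\<in>antidiag N m. of_real (w j) * of_real (w l))"
proof -
  have "(\<Sum>(j, l)\<in>antidiag N m. of_real (w j) * A j l * of_real (w l)) =
      (\<Sum>(j, l)\<in>antidiag N m. (of_real (w j) * x j) * (of_real (w l) * y l))"
    using assms by (intro sum.cong refl) (auto simp: antidiag_def)
  then show ?thesis
    by (simp add: Hstar_def omega_def case_prod_unfold)
qed

text \<open>The domain of the program carries the positivity of the weight, which makes the divisions
  legal.\<close>

lemma rank1_average_program:
  fixes N p :: nat
  assumes "2 * N < 2 ^ p"
  shows "\<exists>P. num_ops P \<le> 18 * p * 2 ^ p + 8 * 2 ^ p + 2 \<and>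
    (\<forall>(w :: nat \<Rightarrow> real) (x :: nat \<Rightarrow> complex) (y :: nat \<Rightarrow> complex) (A :: nat \<Rightarrow> nat \<Rightarrow> complex).
        (\<forall>j\<in>{1..N}. w j > 0) \<longrightarrow>
        (\<forall>j\<in>{1..N}. \<forall>l\<in>{1..N}. A j l = x j * y l) \<longrightarrow>
        computes P
          (map (\<lambda>j. complex_of_real (w j)) [1..<N + 1] @ map x [1..<N + 1] @ map y [1..<N + 1])
          (map (Hstar N w A) [2..<2 * N + 1]))"
proof -
  define D :: "((nat \<Rightarrow> real) \<times> (nat \<Rightarrow> complex) \<times> (nat \<Rightarrow> complex)) set"
    where "D = {(w, x, y). \<forall>j\<in>{1..N}. w j > 0}"
  define W X Y :: "(nat \<Rightarrow> real) \<times> (nat \<Rightarrow> complex) \<times> (nat \<Rightarrow> complex) \<Rightarrow> nat \<Rightarrow> complex"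
    where "W = (\<lambda>(w, x, y) j. of_real (w j))" and "X = (\<lambda>(w, x, y). x)"
      and "Y = (\<lambda>(w, x, y). y)"
  define fs where "fs = map (\<lambda>j t. W t j) [1..<N + 1] @ map (\<lambda>j t. X t j) [1..<N + 1] @
    map (\<lambda>j t. Y t j) [1..<N + 1]"
  define num where "num m t = (\<Sum>(j, l)\<in>antidiag N m. (W t j * X t j) * (W t l * Y t l))" for m t
  define den where "den m t = (\<Sum>(j, l)\<in>antidiag N m. W t j * W t l)" for m t
  let ?M = "2 ^ p :: nat"
  let ?c = "9 * p * ?M + 3 * ?M + 1"
  let ?I = "{1..N}" and ?J = "{2..2 * N}"
  let ?P = "(\<lambda>j t. W t j * X t j) ` ?I \<union> (\<lambda>j t. W t j * Y t j) ` ?I"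
  have fs: "(\<lambda>t. W t j) \<in> set fs" "(\<lambda>t. X t j) \<in> set fs" "(\<lambda>t. Y t j) \<in> set fs"
    if "j \<in> ?I" for j
  proof -
    have "set fs = (\<lambda>j t. W t j) ` ?I \<union> (\<lambda>j t. X t j) ` ?I \<union> (\<lambda>j t. Y t j) ` ?I"
      by (simp add: fs_def atLeastLessThanSuc_atLeastAtMost Un_assoc del: upt_Suc)
    then show "(\<lambda>t. W t j) \<in> set fs" "(\<lambda>t. X t j) \<in> set fs" "(\<lambda>t. Y t j) \<in> set fs"
      using that by blast+
  qed
  have P: "computable_in D (card ?I * (0 + 0 + 1) + card ?I * (0 + 0 + 1)) (set fs) ?P"
    by (intro computable_in_Un computable_in_image computable_in_mult computable_in_mem fs)
      simp_all
  have "computable_in D ?c (set fs \<union> ?P) (num ` ?J)"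
    unfolding num_def
    by (rule computable_in_mono[OF fast_convolution[OF assms,
          of D "\<lambda>t j. W t j * X t j" "\<lambda>t j. W t j * Y t j"]]) auto
  from computable_in_trans[OF P this]
  have num: "computable_in D (2 * N + ?c) (set fs) (num ` ?J)"
    by (rule computable_in_mono) auto
  have den: "computable_in D ?c (set fs) (den ` ?J)"
    unfolding den_def
    by (rule computable_in_mono[OF fast_convolution[OF assms, of D W W]]) (use fs in auto)
  have den_nonzero: "den m t \<noteq> 0" if "m \<in> ?J" "t \<in> D" for m t
  proof -
    obtain w x y where t: "t = (w, x, y)"
      by (cases t)
    have "den m t = of_real (omega N w m)"
      by (simp add: den_def W_def t omega_def case_prod_unfold)
    then show ?thesis
      using omega_pos[of N w m] that by (simp add: D_def t)
  qed
  have "computable_in D (card ?J * (0 + 0 + 1)) (set fs \<union> (num ` ?J \<union> den ` ?J))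
      ((\<lambda>m t. num m t / den m t) ` ?J)"
    by (intro computable_in_image computable_in_divide computable_in_mem den_nonzero) auto
  from computable_in_trans[OF computable_in_Un[OF num den] this]
  have "computable_in D (18 * p * ?M + 8 * ?M + 2) (set fs)
      (set (map (\<lambda>m t. num m t / den m t) [2..<2 * N + 1]))"
    by (rule computable_in_mono) (use assms in \<open>auto simp: algebra_simps\<close>)
  from computable_in_imp_program[OF this] obtain P where
    ops: "num_ops P \<le> 18 * p * ?M + 8 * ?M + 2" and
    P: "\<And>t. t \<in> D \<Longrightarrow> computes P (map (\<lambda>f. f t) fs)
      (map (\<lambda>h. h t) (map (\<lambda>m t. num m t / den m t) [2..<2 * N + 1]))"
    by blast
  show ?thesis
  proof (intro exI[of _ P] conjI allI impI)
    fix w :: "nat \<Rightarrow> real" and x y :: "nat \<Rightarrow> complex" and A :: "nat \<Rightarrow> nat \<Rightarrow> complex"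
    assume w: "\<forall>j\<in>{1..N}. w j > 0" and A: "\<forall>j\<in>{1..N}. \<forall>l\<in>{1..N}. A j l = x j * y l"
    have "Hstar N w A m = num m (w, x, y) / den m (w, x, y)" for m
      unfolding Hstar_rank1[OF A] by (simp add: num_def den_def W_def X_def Y_def)
    then have outputs: "map (\<lambda>h. h (w, x, y)) (map (\<lambda>m t. num m t / den m t) [2..<2 * N + 1]) =
        map (Hstar N w A) [2..<2 * N + 1]"
      by simp
    have inputs: "map (\<lambda>f. f (w, x, y)) fs =
        map (\<lambda>j. complex_of_real (w j)) [1..<N + 1] @ map x [1..<N + 1] @ map y [1..<N + 1]"
      by (simp add: fs_def W_def X_def Y_def comp_def del: upt_Suc)
    have "(w, x, y) \<in> D"
      using w by (simp add: D_def)
    from P[OF this] show "computes P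
        (map (\<lambda>j. complex_of_real (w j)) [1..<N + 1] @ map x [1..<N + 1] @ map y [1..<N + 1])
        (map (Hstar N w A) [2..<2 * N + 1])"
      unfolding inputs outputs .
  qed (rule ops)
qed

lemma ex_power_of_2_between:
  assumes "1 \<le> (N :: nat)"
  shows "\<exists>p. 2 * N < 2 ^ p \<and> 2 ^ p \<le> 4 * N"
proof -
  obtain q where "2 ^ q \<le> N" "N < 2 ^ (q + 1)"
    using ex_power_ivl1[of 2 N] assms by auto
  then show ?thesis
    by (intro exI[of _ "q + 2"]) auto
qed

lemma rank1_average_program_linearithmic:
  fixes N :: nat
  assumes "1 \<le> N"
  shows "\<exists>P. real (num_ops P) \<le> 72 * real N * log 2 (4 * real N) + 34 * real N \<and>
    (\<forall>(w :: nat \<Rightarrow> real) (x :: nat \<Rightarrow> complex) (y :: nat \<Rightarrow> complex) (A :: nat \<Rightarrow> nat \<Rightarrow> complex).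
        (\<forall>j\<in>{1..N}. w j > 0) \<longrightarrow>
        (\<forall>j\<in>{1..N}. \<forall>l\<in>{1..N}. A j l = x j * y l) \<longrightarrow>
        computes P
          (map (\<lambda>j. complex_of_real (w j)) [1..<N + 1] @ map x [1..<N + 1] @ map y [1..<N + 1])
          (map (Hstar N w A) [2..<2 * N + 1]))"
    (is "\<exists>P. _ \<and> ?correct P")
proof -
  obtain p where p: "2 * N < 2 ^ p" "2 ^ p \<le> 4 * N"
    using ex_power_of_2_between[OF assms] by blast
  obtain P where ops: "num_ops P \<le> 18 * p * 2 ^ p + 8 * 2 ^ p + 2" and P: "?correct P"
    using rank1_average_program[OF p(1)] by blast
  have M: "2 ^ p \<le> 4 * real N"
    using p(2) by (metis of_nat_le_iff of_nat_mult of_nat_numeral of_nat_power)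
  then have "real p \<le> log 2 (4 * real N)"
    using assms by (simp add: le_log_iff powr_realpow)
  then have "real p * 2 ^ p \<le> log 2 (4 * real N) * (4 * real N)"
    using M by (intro mult_mono) auto
  moreover have "real (num_ops P) \<le> 18 * (real p * 2 ^ p) + 8 * 2 ^ p + 2"
    using of_nat_mono[OF ops, where 'a = real] by simp
  ultimately have "real (num_ops P) \<le> 72 * real N * log 2 (4 * real N) + 34 * real N"
    using M assms by (simp add: mult_ac)
  then show ?thesis
    using P by blast
qed

theorem proposition6:
  "\<exists>P :: nat \<Rightarrow> program.
     (\<forall>N\<ge>1. \<forall>(w :: nat \<Rightarrow> real) (x :: nat \<Rightarrow> complex) (y :: nat \<Rightarrow> complex)
          (A :: nat \<Rightarrow> nat \<Rightarrow> complex).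
        (\<forall>j\<in>{1..N}. w j > 0) \<longrightarrow>
        (\<forall>j\<in>{1..N}. \<forall>l\<in>{1..N}. A j l = x j * y l) \<longrightarrow>
        computes (P N)
          (map (\<lambda>j. complex_of_real (w j)) [1..<N + 1] @ map x [1..<N + 1] @ map y [1..<N + 1])
          (map (Hstar N w A) [2..<2 * N + 1])) \<and>
     (\<lambda>N. real (num_ops (P N))) \<in> O(\<lambda>N. real N * ln (real N))"
  (is "\<exists>P. (\<forall>N\<ge>1. ?correct N (P N)) \<and> _")
proof -
  have "\<forall>N\<in>{1..}. \<exists>P. real (num_ops P) \<le> 72 * real N * log 2 (4 * real N) + 34 * real N \<and>
      ?correct N P"
    using rank1_average_program_linearithmic by simp
  from bchoice[OF this] obtain P where
    P: "\<forall>N\<in>{1..}. real (num_ops (P N)) \<le> 72 * real N * log 2 (4 * real N) + 34 * real N \<and>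
      ?correct N (P N)" ..
  have "eventually (\<lambda>N. norm (real (num_ops (P N))) \<le>
      norm (72 * real N * log 2 (4 * real N) + 34 * real N)) at_top"
    using eventually_ge_at_top[of 1]
  proof eventually_elim
    case (elim N)
    then have "real (num_ops (P N)) \<le> 72 * real N * log 2 (4 * real N) + 34 * real N"
      using P by simp
    then show ?case by simp
  qed
  then have "(\<lambda>N. real (num_ops (P N))) \<in>
      O(\<lambda>N. 72 * real N * log 2 (4 * real N) + 34 * real N)"
    by (rule landau_o.big_mono)
  also have "(\<lambda>N. 72 * real N * log 2 (4 * real N) + 34 * real N) \<in>
      O(\<lambda>N. real N * ln (real N))"
    by real_asymp
  finally show ?thesis
    using P by (intro exI[of _ P]) simp
qed

end
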